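(* Let $d$ be a positive integer, $1 > \delta > 0$ and $1 > \varepsilon > 0$. Then there is a positive integer $m = m(d, \delta, \varepsilon)$, depending only on $d,\delta,\varepsilon$, such that for any nonempty finite family $\mathcal{F}$ of sets of diameter one each in $\mathbb{R}^d$, there are $m$ sets $K_1, K_2, \ldots, K_m$ in $\mathbb{R}^d$ of diameter at least $1-\delta$ each such that for any subfamily $\mathcal{F}' \subset \mathcal{F}$ with $|\mathcal{F}'| \ge \varepsilon|\mathcal{F}|$, there is an $i$ satisfying $K_i \subset \operatorname{conv} \left(\bigcup \mathcal{F}'\right)$. Moreover, $m$ can be chosen with $m(d, \delta, \varepsilon) = O_d (\varepsilon^{-2d}\cdot\delta^{-d(d-1)})$.
   Context: The diameter of a set $X\subset\mathbb{R}^d$ is the supremum of Euclidean distances between two of its points. $\bigcup \mathcal{F}'$ denotes the union of all the sets belonging to $\mathcal{F}'$, and $\operatorname{conv}$ denotes convex hull. $m(d,\delta,\varepsilon)=O_d(f(d,\delta,\varepsilon))$ means that there is a constant $C_d$ depending only on $d$ such that $m(d,\delta,\varepsilon)\le C_d\, f(d,\delta,\varepsilon)$. *)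

theory Defs
  imports "HOL-Analysis.Analysis"
begin

end

theory Submission imports Defs begin

text \<open>
  After covering the unit sphere by caps of radius \<open>\<delta>/4\<close>, every member \<open>A\<close> of the family contributes
  a cap centre \<open>u\<close> and points \<open>a\<close>, \<open>b\<close> of its convex hull with \<open>u \<bullet> (b - a) = 1 - \<delta>\<close>. For
  fixed \<open>u\<close> the pairs \<open>(a, b)\<close> lie in a hyperplane of \<open>\<real>\<^sup>d \<times> \<real>\<^sup>d\<close>, so they have a weak
  \<open>\<epsilon>\<close>-net of size \<open>O(\<epsilon>\<^sup>-\<^sup>2\<^sup>d)\<close>. A net point \<open>(x, y)\<close> lies in the same hyperplane, whence
  \<open>{x, y}\<close> has diameter at least \<open>1 - \<delta>\<close>; and in some cap a large subfamily keeps its density.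

  The net is built greedily: by a selection argument every subfamily of density \<open>\<epsilon>\<close> has a point in a
  fraction of order \<open>\<epsilon>\<^sup>2\<^sup>d\<close> of all \<open>2d\<close>-tuples, obtained from a centerpoint, disjoint simplices
  around it, and the colourful Caratheodory theorem. The caps number \<open>O(\<delta>\<^sup>-\<^sup>d)\<close> if \<open>d \<ge> 2\<close> and
  two if \<open>d = 1\<close>, so \<open>O(\<delta>\<^sup>-\<^sup>d\<^sup>(\<^sup>d\<^sup>-\<^sup>1\<^sup>))\<close> in both cases.
\<close>

section \<open>Colourful Caratheodory theorem\<close>

text \<open>Take a choice \<open>t\<close> of one point per colour whose hull is nearest to
  \<open>c\<close>. If \<open>c\<close> is outside, the nearest point \<open>z\<close> lies on a
  proper face and is spanned by fewer than \<open>K\<close> of the points, so one colour is free to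
  be replaced by a point that brings the hull nearer. The number of colours is tied to the affine
  dimension of the points, not to that of the space, so that a hyperplane needs one colour
  less.\<close>

lemma colorful_caratheodory:
  fixes S :: "nat \<Rightarrow> 'a::euclidean_space set"
  assumes "0 < K"
    and fin: "\<And>i. i < K \<Longrightarrow> finite (S i)"
    and c: "\<And>i. i < K \<Longrightarrow> c \<in> convex hull S i"
    and dim: "aff_dim (\<Union>i<K. S i) < int K"
  obtains t where "\<And>i. i < K \<Longrightarrow> t i \<in> S i" "c \<in> convex hull (t ` {..<K})"
proof -
  let ?R = "PiE {..<K} S"
  define f where "f t = infdist c (convex hull (t ` {..<K}))" for t :: "nat \<Rightarrow> 'a"
  have "finite ?R"
    using fin by (intro finite_PiE) auto
  have "S i \<noteq> {}" if "i < K" for i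
    using c[OF that] by auto
  then have "?R \<noteq> {}"
    by (auto simp: PiE_eq_empty_iff)
  then obtain t where t: "t \<in> ?R" and tmin: "\<And>s. s \<in> ?R \<Longrightarrow> f t \<le> f s"
    using \<open>finite ?R\<close> by (metis arg_min_if_finite(1) arg_min_least)
  let ?T = "t ` {..<K}"
  let ?C = "convex hull ?T"
  have tS: "t i \<in> S i" if "i < K" for i
    using t that by auto
  have compact: "compact (convex hull (s ` {..<K}))" for s :: "nat \<Rightarrow> 'a"
    by (intro finite_imp_compact_convex_hull) auto
  have ne: "?C \<noteq> {}"
    using \<open>0 < K\<close> by auto
  have "c \<in> ?C"
  proof (rule ccontr)
    assume "c \<notin> ?C"
    obtain z where z: "z \<in> ?C" and fz: "f t = dist c z"
      using infdist_attains_inf[OF compact_imp_closed[OF compact] ne] unfolding f_def by metis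
    have zmin: "dist c z \<le> dist c y" if "y \<in> ?C" for y
      using that fz infdist_le[OF that, of c] by (simp add: f_def)
    define w where "w = z - c"
    have "w \<noteq> 0"
      using \<open>c \<notin> ?C\<close> z by (auto simp: w_def)
    have supp: "w \<bullet> y \<ge> w \<bullet> z" if "y \<in> ?C" for y
      using any_closest_point_dot[OF convex_convex_hull compact_imp_closed[OF compact] z that, of c] zmin
      by (auto simp: w_def algebra_simps)
    have wc: "w \<bullet> c < w \<bullet> z"
      using \<open>w \<noteq> 0\<close> inner_gt_zero_iff[of w] by (simp add: w_def inner_diff_right)
    have "(?C \<inter> {x. w \<bullet> x = w \<bullet> z}) face_of ?C"
      using supp by (intro face_of_Int_supporting_hyperplane_ge) auto
    then obtain T' where T': "T' \<subseteq> ?T" "?C \<inter> {x. w \<bullet> x = w \<bullet> z} = convex hull T'"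
      using face_of_convex_hull_subset[of ?T] finite_imp_compact[of ?T] by auto
    have zT': "z \<in> convex hull T'"
      using z T' by auto
    have "T' \<subseteq> {x. w \<bullet> x = w \<bullet> z}"
      using T' hull_subset[of T' convex] by auto
    then have "affine hull T' \<subseteq> {x. w \<bullet> x = w \<bullet> z}"
      by (intro hull_minimal affine_hyperplane)
    \<comment> \<open>Since \<open>c\<close> is off the hyperplane carrying the face, adding it
      raises the dimension by one. The face thus has dimension at most \<open>K - 2\<close>, and
      Caratheodory's theorem inside it uses at most \<open>K - 1\<close> points.\<close>
    then have "c \<notin> affine hull T'"
      using wc by auto
    then have "aff_dim T' + 1 = aff_dim (insert c T')"
      by (simp add: aff_dim_insert)
    also have "\<dots> \<le> aff_dim (affine hull (\<Union>i<K. S i))"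
    proof (intro aff_dim_subset insert_subsetI)
      have "convex hull S 0 \<subseteq> convex hull (\<Union>i<K. S i)"
        using \<open>0 < K\<close> by (intro hull_mono) auto
      then show "c \<in> affine hull (\<Union>i<K. S i)"
        using c[OF \<open>0 < K\<close>] convex_hull_subset_affine_hull by blast
      have "T' \<subseteq> (\<Union>i<K. S i)"
        using T' tS by blast
      then show "T' \<subseteq> affine hull (\<Union>i<K. S i)"
        by (rule order_trans) (rule hull_subset)
    qed
    finally have "aff_dim T' + 1 < int K"
      using dim by simp
    moreover obtain T'' where T'': "finite T''" "T'' \<subseteq> T'" "int (card T'') \<le> aff_dim T' + 1"
        "z \<in> convex hull T''"
      using zT' caratheodory_aff_dim[of T'] by blast
    ultimately have "card T'' < K"
      by linarith
    \<comment> \<open>Fewer than \<open>K\<close> points already span \<open>z\<close>, so some colour can be exchanged freely.\<close>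
    obtain M where M: "M \<subseteq> {..<K}" "inj_on t M" "T'' = t ` M"
      using T''(2) T'(1) by (metis subset_image_inj order_trans)
    then have "card M < K"
      using \<open>card T'' < K\<close> by (simp add: card_image)
    then obtain i where i: "i < K" "i \<notin> M"
      by (metis M(1) card_lessThan lessThan_iff nat_neq_iff subsetI subset_antisym)
    obtain y where y: "y \<in> S i" "w \<bullet> y \<le> w \<bullet> c"
    proof (rule ccontr)
      assume "\<not> thesis"
      then have "S i \<subseteq> {x. w \<bullet> x > w \<bullet> c}"
        using that by force
      then have "convex hull S i \<subseteq> {x. w \<bullet> x > w \<bullet> c}"
        by (intro hull_minimal convex_halfspace_gt)
      then show False
        using c[OF i(1)] by auto
    qed
    define s where "s = t(i := y)"
    have s: "s \<in> ?R"
      using t y i by (auto simp: s_def PiE_iff extensional_def)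
    let ?C' = "convex hull (s ` {..<K})"
    have "T'' \<subseteq> s ` {..<K}"
    proof -
      have "T'' = s ` M" using M i by (auto simp: s_def image_iff)
      then show ?thesis using M by blast
    qed
    then have "z \<in> ?C'"
      using T''(4) hull_mono by blast
    moreover have "y \<in> ?C'"
      using i by (intro hull_inc) (auto simp: s_def image_iff)
    \<comment> \<open>The angle at \<open>z\<close> between the directions to \<open>c\<close> and
      to \<open>y\<close> is acute, so a short move from \<open>z\<close> towards \<open>y\<close>
      decreases the distance to \<open>c\<close>.\<close>
    moreover have "(c - z) \<bullet> (y - z) > 0"
    proof -
      have "(c - z) \<bullet> (y - z) = w \<bullet> z - w \<bullet> y" by (simp add: w_def algebra_simps)
      then show ?thesis using y wc by linarith
    qed
    then obtain u where u: "u > 0" "u \<le> 1" "dist (z + u *\<^sub>R (y - z)) c < dist z c"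
      using closer_point_lemma by blast
    ultimately have "z + u *\<^sub>R (y - z) \<in> ?C'"
      using convexD_alt[OF convex_convex_hull, of z "s ` {..<K}" y u]
      by (simp add: algebra_simps)
    then have "f s \<le> dist c (z + u *\<^sub>R (y - z))"
      unfolding f_def by (rule infdist_le)
    then show False
      using u(3) tmin[OF s] fz by (simp add: dist_commute)
  qed
  with tS that show thesis by blast
qed

section \<open>Centerpoints and points in many simplices\<close>

text \<open>Helly's theorem for the hulls of the large index sets: any \<open>DIM('a) + 1\<close> of
  these sets share an index, because their complements are too small to cover \<open>I\<close>.
  Indices instead of points keep track of multiplicities.\<close>

lemma centerpoint:
  fixes p :: "'i \<Rightarrow> 'a::euclidean_space"
  assumes "finite I"
  obtains c where "\<And>J. J \<subseteq> I \<Longrightarrow> (DIM('a) + 1) * card (I - J) < card I \<Longrightarrow> c \<in> convex hull (p ` J)"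
proof -
  let ?h = "DIM('a) + 1"
  define \<J> where "\<J> = {J. J \<subseteq> I \<and> ?h * card (I - J) < card I}"
  define G where "G = (\<lambda>J. convex hull (p ` J)) ` \<J>"
  have "finite \<J>"
    using assms by (simp add: \<J>_def)
  have small: "\<Inter>T \<noteq> {}" if "T \<subseteq> G" "card T \<le> ?h" for T
  proof (cases "T = {}")
    case False
    \<comment> \<open>Different index sets may have the same hull; one index set per hull keeps
      their number at \<open>card T\<close>.\<close>
    obtain \<L> where \<L>: "\<L> \<subseteq> \<J>" "inj_on (\<lambda>J. convex hull (p ` J)) \<L>"
        "T = (\<lambda>J. convex hull (p ` J)) ` \<L>"
      using \<open>T \<subseteq> G\<close> unfolding G_def subset_image_inj by blast
    have fin: "finite \<L>"
      using \<L> \<open>finite \<J>\<close> finite_subset by blast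
    have "card \<L> \<le> ?h"
      using \<L> that by (simp add: card_image)
    have "\<exists>i\<in>I. \<forall>J\<in>\<L>. i \<in> J"
    proof (rule ccontr)
      assume "\<not> ?thesis"
      then have "I \<subseteq> (\<Union>J\<in>\<L>. I - J)"
        by blast
      then have "card I \<le> card (\<Union>J\<in>\<L>. I - J)"
        using assms fin by (intro card_mono) auto
      also have "\<dots> \<le> (\<Sum>J\<in>\<L>. card (I - J))"
        using fin by (rule card_UN_le)
      finally have "?h * card I \<le> (\<Sum>J\<in>\<L>. ?h * card (I - J))"
        by (metis mult_le_mono2 sum_distrib_left)
      also have "\<dots> < (\<Sum>J\<in>\<L>. card I)"
        using fin False \<L> by (intro sum_strict_mono) (auto simp: \<J>_def)
      also have "\<dots> \<le> ?h * card I"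
        using \<open>card \<L> \<le> ?h\<close> by (metis mult_le_mono1 sum_constant of_nat_id)
      finally show False by simp
    qed
    then obtain i where "\<forall>J\<in>\<L>. i \<in> J" by blast
    then have "p i \<in> \<Inter>T"
      by (auto simp: \<L> hull_inc)
    then show ?thesis by blast
  qed simp
  have "\<Inter>G \<noteq> {}"
  \<comment> \<open>Helly's theorem is applied to families of at least \<open>?h\<close> members; a
    smaller \<open>G\<close> is itself an instance of \<open>small\<close>.\<close>
  proof (cases "card G \<ge> ?h")
    case True
    then show ?thesis
    proof (rule Helly)
      show "\<forall>s\<in>G. convex s"
        by (simp add: G_def)
    qed (simp add: small)
  next
    case False
    then show ?thesis
      using small by simp
  qed
  then show thesis
    using that by (auto simp: G_def \<J>_def)
qed

text \<open>A maximal disjoint family works. Were it too small, the at most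
  \<open>DIM('a) + 1\<close> vertices of each member would use up less than a fraction
  \<open>1 / (DIM('a) + 1)\<close> of \<open>I\<close>; the centerpoint property would still hold
  for the remaining indices, and Caratheodory's theorem would yield a further simplex.\<close>

lemma disjoint_simplices:
  fixes p :: "'i \<Rightarrow> 'a::euclidean_space"
  assumes "finite I"
    and c: "\<And>J. J \<subseteq> I \<Longrightarrow> (DIM('a) + 1) * card (I - J) < card I \<Longrightarrow> c \<in> convex hull (p ` J)"
  obtains \<S> where "\<And>S. S \<in> \<S> \<Longrightarrow> S \<subseteq> I \<and> c \<in> convex hull (p ` S)" "disjoint \<S>"
    "card I \<le> (DIM('a) + 1)\<^sup>2 * card \<S>"
proof -
  let ?h = "DIM('a) + 1"
  define P where "P \<S> \<longleftrightarrow> (\<forall>S\<in>\<S>. S \<subseteq> I \<and> card S \<le> ?h \<and> c \<in> convex hull (p ` S)) \<and> disjoint \<S>" for \<S>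
  have sub: "\<S> \<subseteq> Pow I" if "P \<S>" for \<S>
    using that by (auto simp: P_def)
  have "P {}"
    by (simp add: P_def)
  moreover have "\<forall>\<S>. P \<S> \<longrightarrow> card \<S> < Suc (card (Pow I))"
    using sub assms(1) by (metis card_mono finite_Pow_iff le_imp_less_Suc)
  ultimately obtain \<S> where \<S>: "P \<S>" and smax: "\<And>\<T>. P \<T> \<Longrightarrow> card \<T> \<le> card \<S>"
    using ex_has_greatest_nat[of P "{}" card] by blast
  have "finite \<S>"
    using sub[OF \<S>] assms(1) finite_subset by blast
  have "card I \<le> ?h\<^sup>2 * card \<S>"
  proof (rule ccontr)
    assume less: "\<not> ?thesis"
    let ?J = "I - \<Union>\<S>"
    have "card (I - ?J) \<le> card (\<Union>\<S>)"
      using \<open>finite \<S>\<close> sub[OF \<S>] assms(1) by (intro card_mono) (auto intro: finite_subset)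
    also have "\<dots> \<le> (\<Sum>S\<in>\<S>. card S)"
      using card_UN_le[OF \<open>finite \<S>\<close>, of id] by simp
    also have "\<dots> \<le> (\<Sum>S\<in>\<S>. ?h)"
      using \<S> by (intro sum_mono) (auto simp: P_def)
    also have "\<dots> = ?h * card \<S>"
      by simp
    finally have "?h * card (I - ?J) \<le> ?h\<^sup>2 * card \<S>"
      by (metis mult_le_mono2 power2_eq_square mult.assoc)
    then have "c \<in> convex hull (p ` ?J)"
      using less by (intro c) auto
    then obtain T where T: "finite T" "T \<subseteq> p ` ?J" "card T \<le> ?h" "c \<in> convex hull T"
      using caratheodory[of "p ` ?J"] by blast
    obtain S where S: "S \<subseteq> ?J" "inj_on p S" "T = p ` S"
      using T(2) unfolding subset_image_inj by blast
    \<comment> \<open>A nonempty set that avoids \<open>\<Union>\<S>\<close> is not a member of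
      \<open>\<S>\<close>, so inserting it increases the cardinality.\<close>
    have "S \<noteq> {}"
      using T(4) S(3) by auto
    then have "S \<notin> \<S>"
      using S(1) by blast
    moreover have "P (insert S \<S>)"
      using \<S> S T unfolding P_def by (auto simp: card_image disjoint_def)
    ultimately show False
      using smax \<open>finite \<S>\<close> by fastforce
  qed
  then show thesis
    using that \<S> by (auto simp: P_def)
qed

text \<open>Ordered tuples with repetition are used, so that the total is exactly
  \<open>card I ^ K\<close>.\<close>

definition pierced :: "('i \<Rightarrow> 'a::real_vector) \<Rightarrow> nat \<Rightarrow> 'i set \<Rightarrow> 'a set \<Rightarrow> (nat \<Rightarrow> 'i) set" where
  "pierced p K I N = {t \<in> {..<K} \<rightarrow>\<^sub>E I. convex hull (p ` t ` {..<K}) \<inter> N \<noteq> {}}"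

text \<open>The point is a centerpoint. Treat any \<open>K\<close> of the disjoint simplices around
  it, repetition allowed, as colour classes: colourful Caratheodory gives a tuple with one vertex
  from each whose hull contains \<open>c\<close>. Different choices of simplices give different
  tuples, so at least \<open>card \<S> ^ K\<close> tuples are counted.\<close>

lemma selection:
  fixes p :: "'i \<Rightarrow> 'a::euclidean_space"
  assumes "finite I" "I \<noteq> {}" "0 < K" and dim: "aff_dim (p ` I) < int K"
  obtains c where "c \<in> convex hull (p ` I)"
    "(real (card I) / (real (DIM('a)) + 1)\<^sup>2) ^ K \<le> real (card (pierced p K I {c}))"
proof -
  obtain c where c: "\<And>J. J \<subseteq> I \<Longrightarrow> (DIM('a) + 1) * card (I - J) < card I \<Longrightarrow> c \<in> convex hull (p ` J)"
    using centerpoint[OF \<open>finite I\<close>, of p] by blast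
  obtain \<S> where \<S>: "\<And>S. S \<in> \<S> \<Longrightarrow> S \<subseteq> I \<and> c \<in> convex hull (p ` S)" and disj: "disjoint \<S>"
    and card: "card I \<le> (DIM('a) + 1)\<^sup>2 * card \<S>"
    using disjoint_simplices[OF \<open>finite I\<close> c] by blast
  have "\<exists>t\<in>{..<K} \<rightarrow>\<^sub>E I. (\<forall>i<K. t i \<in> s i) \<and> c \<in> convex hull (p ` t ` {..<K})"
    if s: "s \<in> {..<K} \<rightarrow>\<^sub>E \<S>" for s
  proof -
    have sI: "s i \<subseteq> I" "c \<in> convex hull (p ` s i)" if "i < K" for i
      using s \<S>[of "s i"] that by auto
    have "aff_dim (\<Union>i<K. p ` s i) \<le> aff_dim (p ` I)"
      using sI by (intro aff_dim_subset) blast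
    then obtain q where q: "\<And>i. i < K \<Longrightarrow> q i \<in> p ` s i" "c \<in> convex hull (q ` {..<K})"
      using colorful_caratheodory[of K "\<lambda>i. p ` s i" c] sI \<open>0 < K\<close> dim finite_subset[OF _ \<open>finite I\<close>]
      by (metis finite_imageI order_le_less_trans)
    define t where "t = (\<lambda>i\<in>{..<K}. SOME x. x \<in> s i \<and> p x = q i)"
    have t: "t i \<in> s i \<and> p (t i) = q i" if "i < K" for i
    proof -
      have "\<exists>x. x \<in> s i \<and> p x = q i" using q(1)[OF that] by auto
      from someI_ex[OF this] show ?thesis using that by (simp add: t_def)
    qed
    then have "p ` t ` {..<K} = q ` {..<K}"
      by (force simp: image_iff)
    moreover have "t \<in> {..<K} \<rightarrow>\<^sub>E I"
      using t sI by (auto simp: PiE_iff extensional_def t_def)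
    ultimately show ?thesis
      using t q by (intro bexI[of _ t]) auto
  qed
  then obtain T where T: "\<And>s. s \<in> {..<K} \<rightarrow>\<^sub>E \<S> \<Longrightarrow> T s \<in> {..<K} \<rightarrow>\<^sub>E I \<and> (\<forall>i<K. T s i \<in> s i)
      \<and> c \<in> convex hull (p ` T s ` {..<K})"
    by metis
  \<comment> \<open>The tuple determines the simplices: each of its entries lies in only one of the
    disjoint sets.\<close>
  have "inj_on T ({..<K} \<rightarrow>\<^sub>E \<S>)"
  proof (rule inj_onI)
    fix s s' assume s: "s \<in> {..<K} \<rightarrow>\<^sub>E \<S>" "s' \<in> {..<K} \<rightarrow>\<^sub>E \<S>" "T s = T s'"
    have "s i = s' i" if "i < K" for i
    proof (rule ccontr)
      assume "s i \<noteq> s' i"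
      moreover have "s i \<in> \<S>" "s' i \<in> \<S>" using s that by auto
      ultimately have "s i \<inter> s' i = {}" using disj by (simp add: disjointD)
      moreover have "T s i \<in> s i" "T s' i \<in> s' i" using T s(1,2) that by blast+
      ultimately show False using s(3) by auto
    qed
    then show "s = s'"
      using s by (intro PiE_ext) auto
  qed
  moreover have "T ` ({..<K} \<rightarrow>\<^sub>E \<S>) \<subseteq> pierced p K I {c}"
    using T by (auto simp: pierced_def)
  moreover have "finite (pierced p K I {c})"
    using \<open>finite I\<close> by (simp add: pierced_def finite_PiE)
  ultimately have le: "card ({..<K} \<rightarrow>\<^sub>E \<S>) \<le> card (pierced p K I {c})"
    by (metis card_inj_on_le)
  have "real (card I) \<le> real ((DIM('a) + 1)\<^sup>2 * card \<S>)"
    using card of_nat_le_iff by blast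
  then have "real (card I) \<le> (real (DIM('a)) + 1)\<^sup>2 * real (card \<S>)"
    by (simp add: algebra_simps)
  then have "real (card I) / (real (DIM('a)) + 1)\<^sup>2 \<le> real (card \<S>)"
    by (subst pos_divide_le_eq) (auto simp: mult.commute intro!: zero_less_power)
  then have "(real (card I) / (real (DIM('a)) + 1)\<^sup>2) ^ K \<le> real (card \<S>) ^ K"
    by (intro power_mono) auto
  also have "\<dots> = real (card ({..<K} \<rightarrow>\<^sub>E \<S>))"
    by (simp add: card_PiE)
  also have "\<dots> \<le> real (card (pierced p K I {c}))"
    using le by simp
  finally have "(real (card I) / (real (DIM('a)) + 1)\<^sup>2) ^ K \<le> real (card (pierced p K I {c}))" .
  moreover have "c \<in> convex hull (p ` I)"
    using c[of I] assms by (simp add: card_gt_0_iff)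
  ultimately show thesis
    using that by blast
qed

section \<open>Weak epsilon-nets\<close>

text \<open>Greedy counting: each point added to the net pierces at least \<open>\<kappa>\<close>
  tuples that were not pierced before, and there are only \<open>card I ^ K\<close> tuples. The
  greedy process is expressed by a set of maximal cardinality among those satisfying the invariant
  \<open>P\<close>.\<close>

lemma weak_epsilon_net:
  fixes p :: "'i \<Rightarrow> 'a::euclidean_space"
  assumes "finite I" "0 < K" and dim: "aff_dim (p ` I) < int K" and "0 < \<epsilon>"
  obtains N where "finite N" "N \<subseteq> convex hull (p ` I)"
    "real (card N) \<le> ((real (DIM('a)) + 1)\<^sup>2 / \<epsilon>) ^ K"
    "\<And>J. J \<subseteq> I \<Longrightarrow> J \<noteq> {} \<Longrightarrow> \<epsilon> * real (card I) \<le> real (card J) \<Longrightarrow> convex hull (p ` J) \<inter> N \<noteq> {}"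
proof (cases "I = {}")
  case True
  then show thesis
    using that[of "{}"] \<open>0 < \<epsilon>\<close> by auto
next
  case False
  define H where "H = (real (DIM('a)) + 1)\<^sup>2"
  \<comment> \<open>The number of tuples that the selection argument guarantees for a subset of
    density \<open>\<epsilon>\<close>.\<close>
  define \<kappa> where "\<kappa> = (\<epsilon> * real (card I) / H) ^ K"
  have "H > 0"
    by (auto simp: H_def intro!: zero_less_power)
  have "card I > 0"
    using False assms by (simp add: card_gt_0_iff)
  then have "\<kappa> > 0"
    using \<open>H > 0\<close> \<open>0 < \<epsilon>\<close> by (simp add: \<kappa>_def)
  have fin: "finite (pierced p K I N)" for N
    using \<open>finite I\<close> by (simp add: pierced_def finite_PiE)
  define P where "P N \<longleftrightarrow> finite N \<and> N \<subseteq> convex hull (p ` I) \<and> real (card N) * \<kappa> \<le> real (card (pierced p K I N))" for N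
  have bound: "real (card N) \<le> (H / \<epsilon>) ^ K" if "P N" for N
  proof -
    have "card (pierced p K I N) \<le> card ({..<K} \<rightarrow>\<^sub>E I)"
      using \<open>finite I\<close> by (intro card_mono finite_PiE) (auto simp: pierced_def)
    then have "real (card (pierced p K I N)) \<le> real (card I) ^ K"
      by (simp add: card_PiE flip: of_nat_power)
    then have "real (card N) * \<kappa> \<le> real (card I) ^ K"
      using that unfolding P_def by linarith
    then have "real (card N) \<le> real (card I) ^ K / \<kappa>"
      using \<open>\<kappa> > 0\<close> by (simp add: pos_le_divide_eq)
    also have "\<dots> = (H / \<epsilon>) ^ K"
      using \<open>card I > 0\<close> by (simp add: \<kappa>_def power_divide power_mult_distrib)
    finally show ?thesis .
  qed
  have "P {}"
    by (simp add: P_def)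
  moreover have "\<forall>N. P N \<longrightarrow> card N < Suc (nat \<lfloor>(H / \<epsilon>) ^ K\<rfloor>)"
    using bound by (metis le_nat_floor le_imp_less_Suc)
  ultimately obtain N where N: "P N" and Nmax: "\<And>N'. P N' \<Longrightarrow> card N' \<le> card N"
    using ex_has_greatest_nat[of P "{}" card] by blast
  have "convex hull (p ` J) \<inter> N \<noteq> {}"
    if J: "J \<subseteq> I" "J \<noteq> {}" "\<epsilon> * real (card I) \<le> real (card J)" for J
  proof
    assume disj: "convex hull (p ` J) \<inter> N = {}"
    have "aff_dim (p ` J) < int K"
      using dim J(1) by (meson aff_dim_subset image_mono order_le_less_trans)
    then obtain c where c: "c \<in> convex hull (p ` J)"
        "(real (card J) / H) ^ K \<le> real (card (pierced p K J {c}))"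
      using selection[of J K p] J \<open>0 < K\<close> finite_subset[OF J(1) \<open>finite I\<close>] unfolding H_def by metis
    have "\<kappa> \<le> (real (card J) / H) ^ K"
      unfolding \<kappa>_def using J(3) \<open>H > 0\<close> \<open>0 < \<epsilon>\<close> by (intro power_mono divide_right_mono) auto
    then have \<kappa>: "\<kappa> \<le> real (card (pierced p K J {c}))"
      using c by linarith
    \<comment> \<open>The tuples pierced by \<open>c\<close> are new: they are taken from
      \<open>J\<close>, so their hulls stay in the hull of \<open>J\<close>, which \<open>N\<close>
      misses.\<close>
    have "convex hull (p ` t ` {..<K}) \<subseteq> convex hull (p ` J)" if "t \<in> {..<K} \<rightarrow>\<^sub>E J" for t
      using that by (intro hull_mono) auto
    then have "pierced p K I N \<inter> pierced p K J {c} = {}"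
      using disj unfolding pierced_def by blast
    moreover have "finite (pierced p K J {c})"
      using finite_subset[OF J(1) \<open>finite I\<close>] by (simp add: pierced_def finite_PiE)
    ultimately have "real (card (pierced p K I N)) + real (card (pierced p K J {c}))
        = real (card (pierced p K I N \<union> pierced p K J {c}))"
      using fin by (simp add: card_Un_disjoint)
    also have "\<dots> \<le> real (card (pierced p K I (insert c N)))"
      using J(1) by (intro of_nat_mono card_mono fin) (fastforce simp: pierced_def PiE_iff)
    finally have "real (card N) * \<kappa> + \<kappa> \<le> real (card (pierced p K I (insert c N)))"
      using \<kappa> N by (simp add: P_def)
    moreover have "c \<notin> N"
      using disj c by blast
    moreover have "c \<in> convex hull (p ` I)"
      using c(1) hull_mono[OF image_mono[OF J(1), of p], of convex] by blast
    ultimately have "P (insert c N)"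
      using N by (simp add: P_def algebra_simps)
    then have "card (insert c N) \<le> card N"
      by (rule Nmax)
    then show False
      using N \<open>c \<notin> N\<close> by (simp add: P_def)
  qed
  then show thesis
    using that N bound unfolding P_def H_def by blast
qed

section \<open>From sets of diameter one to pairs of points\<close>

text \<open>Two points at distance above \<open>1 - \<delta> / 2\<close>, whose direction is within
  \<open>\<delta> / 4\<close> of \<open>u\<close>, have a component of at least
  \<open>1 - \<delta>\<close> along \<open>u\<close>. The segment is then shortened to reach
  equality, which is what places all pairs for the same \<open>u\<close> in one hyperplane.\<close>

lemma segment_of_diameter_1:
  fixes A :: "'a::euclidean_space set"
  assumes A: "bounded A" "diameter A = 1" and \<delta>: "0 < \<delta>" "\<delta> < 1"
    and cover: "\<And>v. norm v = 1 \<Longrightarrow> \<exists>u\<in>U. norm (v - u) \<le> \<delta> / 4"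
  obtains u x y where "u \<in> U" "x \<in> convex hull A" "y \<in> convex hull A" "u \<bullet> (y - x) = 1 - \<delta>"
proof -
  obtain a b where ab: "a \<in> A" "b \<in> A" "1 - \<delta> / 2 < dist a b"
    using diameter_lower_bounded[of A "1 - \<delta> / 2"] A \<delta> by auto
  define v where "v = (b - a) /\<^sub>R norm (b - a)"
  have "a \<noteq> b"
    using ab \<delta> by auto
  then have v: "norm v = 1" "b - a = norm (b - a) *\<^sub>R v"
    by (auto simp: v_def)
  obtain u where u: "u \<in> U" "norm (v - u) \<le> \<delta> / 4"
    using cover[OF v(1)] by blast
  have "(v - u) \<bullet> v \<le> \<delta> / 4"
    using norm_cauchy_schwarz[of "v - u" v] u v by simp
  then have uv: "1 - \<delta> / 4 \<le> u \<bullet> v"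
    using v(1) by (simp add: inner_diff_left flip: power2_norm_eq_inner)
  define L where "L = u \<bullet> (b - a)"
  have "1 - \<delta> \<le> (1 - \<delta> / 2) * (1 - \<delta> / 4)"
    using \<delta> by (simp add: algebra_simps)
  also have "\<dots> \<le> norm (b - a) * (u \<bullet> v)"
    using ab(3) uv \<delta> by (intro mult_mono) (auto simp: dist_norm norm_minus_commute)
  also have "\<dots> = L"
    unfolding L_def by (subst (2) v(2)) simp
  finally have L: "1 - \<delta> \<le> L" .
  \<comment> \<open>By \<open>L\<close>, the factor is at most 1, so \<open>y\<close> stays on the
    segment from \<open>a\<close> to \<open>b\<close>.\<close>
  define y where "y = a + ((1 - \<delta>) / L) *\<^sub>R (b - a)"
  have "L > 0"
    using L \<delta> by linarith
  have "y = (1 - (1 - \<delta>) / L) *\<^sub>R a + ((1 - \<delta>) / L) *\<^sub>R b"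
    by (simp add: y_def algebra_simps)
  also have "\<dots> \<in> convex hull A"
    using L \<open>L > 0\<close> \<delta> ab by (intro convexD_alt convex_convex_hull hull_inc) auto
  finally have "y \<in> convex hull A" .
  moreover have "u \<bullet> (y - a) = 1 - \<delta>"
    using \<open>L > 0\<close> by (simp add: y_def flip: L_def)
  ultimately show thesis
    using that u(1) ab(1) hull_inc by metis
qed

text \<open>If every nonempty fibre had smaller density, summation over the fibres would contradict
  the density of \<open>F'\<close>. No density is lost, so the number of caps enters the size of the
  final net only as a factor.\<close>

lemma exists_dense_fibre:
  fixes \<epsilon> :: real
  assumes "finite F" "F \<noteq> {}" "F' \<subseteq> F" "g ` F \<subseteq> U"
    and "\<epsilon> * real (card F) \<le> real (card F')"
  obtains u where "u \<in> U" "F \<inter> g -` {u} \<noteq> {}"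
    "\<epsilon> * real (card (F \<inter> g -` {u})) \<le> real (card (F' \<inter> g -` {u}))"
proof (rule ccontr)
  assume neg: "\<not> thesis"
  have fibres: "card G = (\<Sum>u\<in>g ` F. card (G \<inter> g -` {u}))" if "G \<subseteq> F" for G
  proof -
    have "finite G"
      using that \<open>finite F\<close> finite_subset by blast
    have "G = (\<Union>u\<in>g ` F. G \<inter> g -` {u})"
      using that by auto
    then have "card G = card (\<Union>u\<in>g ` F. G \<inter> g -` {u})"
      by simp
    also have "\<dots> = (\<Sum>u\<in>g ` F. card (G \<inter> g -` {u}))"
      using \<open>finite F\<close> \<open>finite G\<close> by (intro card_UN_disjoint) auto
    finally show ?thesis .
  qed
  have "real (card F') = (\<Sum>u\<in>g ` F. real (card (F' \<inter> g -` {u})))"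
    using fibres[OF assms(3)] by simp
  also have "\<dots> < (\<Sum>u\<in>g ` F. \<epsilon> * real (card (F \<inter> g -` {u})))"
  proof (rule sum_strict_mono)
    fix u assume "u \<in> g ` F"
    then have "u \<in> U" "F \<inter> g -` {u} \<noteq> {}"
      using assms(4) by auto
    then show "real (card (F' \<inter> g -` {u})) < \<epsilon> * real (card (F \<inter> g -` {u}))"
      using neg that by (meson not_le)
  qed (use assms in auto)
  also have "\<dots> = \<epsilon> * real (card F)"
    using fibres[OF order_refl] by (simp add: sum_distrib_left)
  finally show False
    using assms(5) by linarith
qed

text \<open>The net is the union over the caps \<open>u\<close> of weak nets for the pairs of
  endpoints in the product space. A net point is a convex combination of such pairs, hence again a
  pair in the same hyperplane, and it lies in the square of every convex set that contains the
  segments used.\<close>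

lemma segment_net:
  fixes F :: "'a::euclidean_space set set"
  assumes F: "finite F" "F \<noteq> {}" and diam: "\<And>A. A \<in> F \<Longrightarrow> bounded A \<and> diameter A = 1"
    and \<delta>: "0 < \<delta>" "\<delta> < 1" and "0 < \<epsilon>"
    and U: "finite (U :: 'a set)" "\<And>u. u \<in> U \<Longrightarrow> norm u = 1"
    and cover: "\<And>v. norm v = 1 \<Longrightarrow> \<exists>u\<in>U. norm (v - u) \<le> \<delta> / 4"
  obtains N where "finite N"
    "real (card N) \<le> real (card U) * ((2 * real DIM('a) + 1)\<^sup>2 / \<epsilon>) ^ (2 * DIM('a))"
    "\<And>x y. (x, y) \<in> N \<Longrightarrow> 1 - \<delta> \<le> dist x y"
    "\<And>F'. F' \<subseteq> F \<Longrightarrow> \<epsilon> * real (card F) \<le> real (card F') \<Longrightarrow>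
       \<exists>(x, y)\<in>N. {x, y} \<subseteq> convex hull (\<Union>F')"
proof -
  let ?d = "DIM('a)"
  have "\<exists>u x y. u \<in> U \<and> x \<in> convex hull A \<and> y \<in> convex hull A \<and> u \<bullet> (y - x) = 1 - \<delta>"
    if "A \<in> F" for A
    using segment_of_diameter_1[of A \<delta> U] diam[OF that] \<delta> cover by metis
  then obtain g a b where gU: "\<And>A. A \<in> F \<Longrightarrow> g A \<in> U"
    and a: "\<And>A. A \<in> F \<Longrightarrow> a A \<in> convex hull A" and b: "\<And>A. A \<in> F \<Longrightarrow> b A \<in> convex hull A"
    and ab: "\<And>A. A \<in> F \<Longrightarrow> g A \<bullet> (b A - a A) = 1 - \<delta>"
    by metis
  define p where "p A = (a A, b A)" for A
  define I where "I u = F \<inter> g -` {u}" for u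
  define H where "H u = {z. (- u, u) \<bullet> z = 1 - \<delta>}" for u :: 'a
  have H_iff: "(x, y) \<in> H u \<longleftrightarrow> u \<bullet> (y - x) = 1 - \<delta>" for u x y
    by (auto simp: H_def algebra_simps)
  have pH: "p ` I u \<subseteq> H u" for u
    using ab by (auto simp: p_def I_def H_iff)
  \<comment> \<open>The hyperplane saves one dimension, and thereby one power of \<open>1/\<epsilon>\<close> in the size of the net.\<close>
  have "\<exists>N. finite N \<and> N \<subseteq> convex hull (p ` I u)
      \<and> real (card N) \<le> ((2 * real ?d + 1)\<^sup>2 / \<epsilon>) ^ (2 * ?d)
      \<and> (\<forall>J. J \<subseteq> I u \<longrightarrow> J \<noteq> {} \<longrightarrow> \<epsilon> * real (card (I u)) \<le> real (card J)
           \<longrightarrow> convex hull (p ` J) \<inter> N \<noteq> {})" if "u \<in> U" for u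
  proof -
    have "u \<noteq> 0"
      using U(2)[OF that] by auto
    then have "aff_dim (H u) = int (2 * ?d) - 1"
      unfolding H_def using DIM_positive[where 'a='a]
      by (subst aff_dim_hyperplane) (auto simp: zero_prod_def of_nat_diff Suc_le_eq)
    then have dim: "aff_dim (p ` I u) < int (2 * ?d)"
      using aff_dim_subset[OF pH[of u]] by linarith
    have fin: "finite (I u)"
      using F by (simp add: I_def)
    have pos: "0 < 2 * ?d"
      by simp
    obtain M where M: "finite M" "M \<subseteq> convex hull (p ` I u)"
      "real (card M) \<le> ((real DIM('a \<times> 'a) + 1)\<^sup>2 / \<epsilon>) ^ (2 * ?d)"
      "\<And>J. J \<subseteq> I u \<Longrightarrow> J \<noteq> {} \<Longrightarrow> \<epsilon> * real (card (I u)) \<le> real (card J)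
        \<Longrightarrow> convex hull (p ` J) \<inter> M \<noteq> {}"
      by (rule weak_epsilon_net[OF fin pos dim \<open>0 < \<epsilon>\<close>]) (rule that)
    have "real DIM('a \<times> 'a) + 1 = 2 * real ?d + 1"
      by simp
    with M show ?thesis
      by metis
  qed
  then obtain N where N: "\<And>u. u \<in> U \<Longrightarrow> finite (N u) \<and> N u \<subseteq> convex hull (p ` I u)
      \<and> real (card (N u)) \<le> ((2 * real ?d + 1)\<^sup>2 / \<epsilon>) ^ (2 * ?d)
      \<and> (\<forall>J. J \<subseteq> I u \<longrightarrow> J \<noteq> {} \<longrightarrow> \<epsilon> * real (card (I u)) \<le> real (card J)
           \<longrightarrow> convex hull (p ` J) \<inter> N u \<noteq> {})"
    by metis
  show thesis
  proof (rule that[of "\<Union>u\<in>U. N u"])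
    show "finite (\<Union>u\<in>U. N u)"
      using N U by blast
    have "real (card (\<Union>u\<in>U. N u)) \<le> (\<Sum>u\<in>U. real (card (N u)))"
      using card_UN_le[OF U(1), of N] by (metis of_nat_le_iff of_nat_sum)
    also have "\<dots> \<le> (\<Sum>u\<in>U. ((2 * real ?d + 1)\<^sup>2 / \<epsilon>) ^ (2 * ?d))"
      using N by (intro sum_mono) blast
    finally show "real (card (\<Union>u\<in>U. N u)) \<le> real (card U) * ((2 * real ?d + 1)\<^sup>2 / \<epsilon>) ^ (2 * ?d)"
      by simp
  next
    fix x y assume "(x, y) \<in> (\<Union>u\<in>U. N u)"
    then obtain u where u: "u \<in> U" "(x, y) \<in> N u"
      by blast
    \<comment> \<open>Averaging pairs keeps the component of \<open>y - x\<close> along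
      \<open>u\<close> equal to \<open>1 - \<delta>\<close>; as \<open>u\<close> is a unit vector,
      this bounds the distance from below.\<close>
    have "convex hull (p ` I u) \<subseteq> H u"
      using pH unfolding H_def by (intro hull_minimal convex_hyperplane)
    then have "(x, y) \<in> H u"
      using N[OF u(1)] u(2) by blast
    then have "1 - \<delta> = u \<bullet> (y - x)"
      by (simp add: H_iff)
    also have "\<dots> \<le> norm u * norm (y - x)"
      by (rule norm_cauchy_schwarz)
    finally show "1 - \<delta> \<le> dist x y"
      using U(2)[OF u(1)] by (simp add: dist_norm norm_minus_commute)
  next
    fix F' assume F': "F' \<subseteq> F" "\<epsilon> * real (card F) \<le> real (card F')"
    have gFU: "g ` F \<subseteq> U"
      using gU by blast
    obtain u where u: "u \<in> U" "I u \<noteq> {}" "\<epsilon> * real (card (I u)) \<le> real (card (F' \<inter> g -` {u}))"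
      by (rule exists_dense_fibre[OF F F'(1) gFU F'(2), folded I_def]) (rule that)
    have "card (I u) > 0"
      using u(2) F by (simp add: I_def card_gt_0_iff)
    then have "0 < \<epsilon> * real (card (I u))"
      using \<open>0 < \<epsilon>\<close> by simp
    \<comment> \<open>The net property speaks of nonempty subfamilies only; the positive lower bound
      on the cardinality provides this.\<close>
    then have "F' \<inter> g -` {u} \<noteq> {}"
      using u(3) by force
    moreover have "F' \<inter> g -` {u} \<subseteq> I u"
      using F'(1) by (auto simp: I_def)
    ultimately obtain z where z: "z \<in> convex hull (p ` (F' \<inter> g -` {u}))" "z \<in> N u"
      using conjunct2[OF conjunct2[OF conjunct2[OF N[OF u(1)]]]] u(3) by (metis disjoint_iff)
    let ?V = "convex hull (\<Union>F')"
    have "p A \<in> ?V \<times> ?V" if "A \<in> F'" for A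
    proof -
      have "convex hull A \<subseteq> ?V"
        using that by (intro hull_mono) blast
      then show ?thesis
        using that F'(1) a b by (auto simp: p_def)
    qed
    then have "convex hull (p ` (F' \<inter> g -` {u})) \<subseteq> ?V \<times> ?V"
      by (intro hull_minimal convex_Times convex_convex_hull image_subsetI) blast
    then show "\<exists>(x, y)\<in>\<Union>u\<in>U. N u. {x, y} \<subseteq> ?V"
      using z u(1) by (intro bexI[of _ z]) auto
  qed
qed

section \<open>Covering the sphere by few caps\<close>

text \<open>Coordinates are rounded to a grid of mesh \<open>r / DIM('a)\<close>. Two points of one
  cell differ by at most the mesh in each coordinate, hence by at most \<open>r\<close> in the sum
  norm, which dominates the Euclidean one. One point of \<open>S\<close> is kept per occupied cell,
  so that the centres of a cover of the sphere are unit vectors.\<close>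

lemma grid_cover:
  fixes S :: "'a::euclidean_space set"
  assumes S: "S \<subseteq> cball 0 1" and r: "0 < r" "r \<le> 1"
  obtains U where "finite U" "U \<subseteq> S" "real (card U) \<le> (5 * real DIM('a) / r) ^ DIM('a)"
    "\<And>v. v \<in> S \<Longrightarrow> \<exists>u\<in>U. norm (v - u) \<le> r"
proof -
  let ?d = "DIM('a)"
  define s where "s = r / real ?d"
  define k where "k = \<lceil>1 / s\<rceil>"
  define key where "key v = (\<lambda>b\<in>Basis. \<lfloor>v \<bullet> b / s\<rfloor>)" for v :: 'a
  have s: "0 < s" "s \<le> 1"
    using r by (auto simp: s_def divide_le_eq) (metis DIM_ge_Suc0 One_nat_def of_nat_1 of_nat_le_iff order_trans)
  have keyS: "key ` S \<subseteq> Basis \<rightarrow>\<^sub>E {-k..k}"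
  proof
    fix f assume "f \<in> key ` S"
    then obtain v where v: "v \<in> S" "f = key v" by blast
    have "-k \<le> \<lfloor>v \<bullet> b / s\<rfloor> \<and> \<lfloor>v \<bullet> b / s\<rfloor> \<le> k" if "b \<in> Basis" for b
    proof -
      have "\<bar>v \<bullet> b\<bar> \<le> 1"
        using norm_bound_Basis_le[OF that, of v 1] v S by auto
      then have "v \<bullet> b / s \<le> 1 / s" "- (1 / s) \<le> v \<bullet> b / s"
        using s by (auto simp: field_simps abs_le_iff)
      then show ?thesis
        unfolding k_def by linarith
    qed
    then show "f \<in> Basis \<rightarrow>\<^sub>E {-k..k}"
      by (auto simp: v key_def)
  qed
  have fin: "finite (Basis \<rightarrow>\<^sub>E {-k..k} :: ('a \<Rightarrow> int) set)"
    by (intro finite_PiE) auto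
  define rep where "rep f = (SOME u. u \<in> S \<and> key u = f)" for f
  have rep: "rep (key v) \<in> S \<and> key (rep (key v)) = key v" if "v \<in> S" for v
    unfolding rep_def using someI[of "\<lambda>u. u \<in> S \<and> key u = key v" v] that by simp
  let ?U = "rep ` key ` S"
  show thesis
  proof (rule that[of ?U])
    show "finite ?U"
      using keyS fin finite_subset by blast
    show "?U \<subseteq> S"
      using rep by auto
    have "k \<ge> 0"
      using s unfolding k_def by (metis ceiling_mono ceiling_zero divide_nonneg_pos less_eq_real_def zero_le_one)
    have "card ?U \<le> card (Basis \<rightarrow>\<^sub>E {-k..k} :: ('a \<Rightarrow> int) set)"
      using keyS fin by (meson card_image_le card_mono finite_subset order_trans)
    also have "\<dots> = (nat (2 * k + 1)) ^ ?d"
      by (simp add: card_PiE)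
    finally have "real (card ?U) \<le> real (nat (2 * k + 1)) ^ ?d"
      by (metis of_nat_le_iff of_nat_power)
    \<comment> \<open>With \<open>s \<le> 1\<close>, the count \<open>2 * k + 1\<close> is at most
      \<open>2 / s + 3\<close>, hence at most \<open>5 / s\<close>.\<close>
    also have "\<dots> \<le> (5 / s) ^ ?d"
    proof (rule power_mono)
      have "1 \<le> 1 / s"
        using s by simp
      moreover have "of_int k \<le> 1 / s + 1"
        unfolding k_def by linarith
      ultimately show "real (nat (2 * k + 1)) \<le> 5 / s"
        using \<open>k \<ge> 0\<close> by simp
    qed simp
    finally show "real (card ?U) \<le> (5 * real ?d / r) ^ ?d"
      by (simp add: s_def)
  next
    fix v assume "v \<in> S"
    let ?u = "rep (key v)"
    have "\<bar>(v - ?u) \<bullet> b\<bar> \<le> s" if b: "b \<in> Basis" for b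
    proof -
      have "key ?u b = key v b"
        using rep[OF \<open>v \<in> S\<close>] by simp
      then have "\<lfloor>?u \<bullet> b / s\<rfloor> = \<lfloor>v \<bullet> b / s\<rfloor>"
        using b by (simp add: key_def)
      then have "\<bar>v \<bullet> b / s - ?u \<bullet> b / s\<bar> \<le> 1"
        by linarith
      then have "\<bar>(v - ?u) \<bullet> b / s\<bar> \<le> 1"
        by (simp add: inner_diff_left diff_divide_distrib)
      then show ?thesis
        using s by (simp add: divide_le_eq)
    qed
    then have "norm (v - ?u) \<le> (\<Sum>b\<in>(Basis :: 'a set). s)"
      by (intro order_trans[OF norm_le_l1] sum_mono)
    then have "norm (v - ?u) \<le> r"
      by (simp add: s_def)
    then show "\<exists>u\<in>?U. norm (v - u) \<le> r"
      using \<open>v \<in> S\<close> by blast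
  qed
qed

text \<open>For \<open>DIM('a) \<ge> 2\<close> the grid gives order \<open>\<delta>\<close> to the
  power \<open>- DIM('a)\<close>, and \<open>DIM('a)\<close> is at most
  \<open>DIM('a) * (DIM('a) - 1)\<close>. In dimension one the exponent in the bound is 0, so a
  number of caps independent of \<delta> is required; the two unit vectors suffice. The 20 is 5
  times 4, from the radius \<open>\<delta> / 4\<close>.\<close>

lemma sphere_cover:
  assumes \<delta>: "0 < \<delta>" "\<delta> < 1"
  obtains U :: "'a::euclidean_space set" where "finite U" "\<And>u. u \<in> U \<Longrightarrow> norm u = 1"
    "real (card U) \<le> (20 * real DIM('a)) ^ DIM('a) * \<delta> powi (- int DIM('a) * (int DIM('a) - 1))"
    "\<And>v. norm v = 1 \<Longrightarrow> \<exists>u\<in>U. norm (v - u) \<le> \<delta> / 4"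
proof (cases "DIM('a) = 1")
  case True
  then obtain b :: 'a where b: "Basis = {b}"
    by (metis card_1_singletonE)
  then have "norm b = 1"
    by (metis norm_Basis insertI1)
  have "v \<in> {b, -b}" if "norm v = 1" for v
  proof -
    have v: "v = (v \<bullet> b) *\<^sub>R b"
      using euclidean_representation[of v] unfolding b by simp
    then have "\<bar>v \<bullet> b\<bar> = 1"
      using that \<open>norm b = 1\<close> by (metis mult.right_neutral norm_scaleR)
    then have "v \<bullet> b = 1 \<or> v \<bullet> b = -1"
      by linarith
    then show ?thesis
      using v by (metis insertCI scaleR_minus1_left scaleR_one)
  qed
  moreover have "real (card {b, -b}) \<le> 20"
    using card_insert_le_m1[of 2 "{-b}" b] by simp
  ultimately show thesis
    using \<delta> \<open>norm b = 1\<close> True by (intro that[of "{b, -b}"]) force+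
next
  case False
  let ?d = "DIM('a)"
  have "?d \<ge> 1"
    by (simp add: DIM_ge_Suc0)
  with False have d: "?d \<ge> 2"
    by linarith
  obtain U :: "'a set" where U: "finite U" "U \<subseteq> sphere 0 1"
      "real (card U) \<le> (5 * real ?d / (\<delta> / 4)) ^ ?d"
      "\<And>v. v \<in> sphere 0 1 \<Longrightarrow> \<exists>u\<in>U. norm (v - u) \<le> \<delta> / 4"
  proof (rule grid_cover[of "sphere 0 1 :: 'a set" "\<delta> / 4"])
    show "sphere 0 1 \<subseteq> (cball 0 1 :: 'a set)"
      by (rule sphere_cball)
  qed (use \<delta> in auto)
  have "5 * real ?d / (\<delta> / 4) = 20 * real ?d * inverse \<delta>"
    by (simp add: field_simps)
  then have "(5 * real ?d / (\<delta> / 4)) ^ ?d = (20 * real ?d) ^ ?d * \<delta> powi (- int ?d)"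
    by (simp only: power_mult_distrib power_int_minus power_int_of_nat power_inverse)
  also have "\<dots> \<le> (20 * real ?d) ^ ?d * \<delta> powi (- int ?d * (int ?d - 1))"
  proof (intro mult_left_mono power_int_decreasing)
    show "- int ?d * (int ?d - 1) \<le> - int ?d"
      using d mult_left_mono[of 1 "int ?d - 1" "int ?d"] by simp
  qed (use \<delta> in auto)
  finally show thesis
    using U by (intro that[of U]) auto
qed

section \<open>Constants and numbering of the net\<close>

theorem theorem4p4:
  "\<exists>(m :: real \<Rightarrow> real \<Rightarrow> nat) (C :: real). \<forall>\<delta> \<epsilon>.
     0 < \<delta> \<and> \<delta> < 1 \<and> 0 < \<epsilon> \<and> \<epsilon> < 1 \<longrightarrow>
       0 < m \<delta> \<epsilon> \<and>
       (\<forall>\<F> :: (real ^ 'n) set set.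
          finite \<F> \<and> \<F> \<noteq> {} \<and> (\<forall>A\<in>\<F>. bounded A \<and> diameter A = 1) \<longrightarrow>
          (\<exists>K :: nat \<Rightarrow> (real ^ 'n) set.
             (\<forall>i\<in>{1..m \<delta> \<epsilon>}. bounded (K i) \<longrightarrow> 1 - \<delta> \<le> diameter (K i)) \<and>
             (\<forall>\<F>'\<subseteq>\<F>. \<epsilon> * real (card \<F>) \<le> real (card \<F>') \<longrightarrow>
                (\<exists>i\<in>{1..m \<delta> \<epsilon>}. K i \<subseteq> convex hull (\<Union>\<F>'))))) \<and>
       real (m \<delta> \<epsilon>) \<le>
         C * (\<epsilon> powi (- 2 * int CARD('n)) *
              \<delta> powi (- int CARD('n) * (int CARD('n) - 1)))"
proof -
  let ?d = "CARD('n)"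
  let ?D = "\<lambda>\<delta>::real. \<delta> powi (- int ?d * (int ?d - 1))"
  \<comment> \<open>The first factor comes from the number of caps, the second from the net in each
    cap, where the product space has dimension \<open>2 * ?d\<close>.\<close>
  define C where "C = (20 * real ?d) ^ ?d * ((2 * real ?d + 1)\<^sup>2) ^ (2 * ?d)"
  define bnd where "bnd \<delta> \<epsilon> = C * (\<epsilon> powi (- 2 * int ?d) * ?D \<delta>)" for \<delta> \<epsilon> :: real
  define m where "m \<delta> \<epsilon> = nat \<lfloor>bnd \<delta> \<epsilon>\<rfloor>" for \<delta> \<epsilon>
  have d: "1 \<le> real ?d"
    by (simp add: Suc_leI)
  have "0 < m \<delta> \<epsilon> \<and>
       (\<forall>\<F> :: (real ^ 'n) set set.
          finite \<F> \<and> \<F> \<noteq> {} \<and> (\<forall>A\<in>\<F>. bounded A \<and> diameter A = 1) \<longrightarrow>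
          (\<exists>K :: nat \<Rightarrow> (real ^ 'n) set.
             (\<forall>i\<in>{1..m \<delta> \<epsilon>}. bounded (K i) \<longrightarrow> 1 - \<delta> \<le> diameter (K i)) \<and>
             (\<forall>\<F>'\<subseteq>\<F>. \<epsilon> * real (card \<F>) \<le> real (card \<F>') \<longrightarrow>
                (\<exists>i\<in>{1..m \<delta> \<epsilon>}. K i \<subseteq> convex hull (\<Union>\<F>'))))) \<and>
       real (m \<delta> \<epsilon>) \<le> bnd \<delta> \<epsilon>"
    if \<delta>: "0 < \<delta>" "\<delta> < 1" and \<epsilon>: "0 < \<epsilon>" "\<epsilon> < 1" for \<delta> \<epsilon>
  proof (intro conjI allI impI)
    have ge1: "1 \<le> x powi n" if "0 < x" "x < 1" "n \<le> 0" for x :: real and n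
      using power_int_decreasing[of n 0 x] that by simp
    \<comment> \<open>All three factors of \<open>bnd \<delta> \<epsilon>\<close> are at least 1, so
      rounding it down leaves a positive integer.\<close>
    have "1 \<le> C"
      unfolding C_def using d by (intro mult_ge1_I one_le_power) auto
    moreover have "1 \<le> \<epsilon> powi (- 2 * int ?d)" "1 \<le> ?D \<delta>"
      using \<delta> \<epsilon> d by (auto intro!: ge1 mult_nonpos_nonneg)
    ultimately have "1 \<le> bnd \<delta> \<epsilon>"
      unfolding bnd_def by (intro mult_ge1_I)
    then show "0 < m \<delta> \<epsilon>" "real (m \<delta> \<epsilon>) \<le> bnd \<delta> \<epsilon>"
      by (auto simp: m_def le_floor_iff)
    fix \<F> :: "(real ^ 'n) set set"
    assume \<F>: "finite \<F> \<and> \<F> \<noteq> {} \<and> (\<forall>A\<in>\<F>. bounded A \<and> diameter A = 1)"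
    obtain U :: "(real ^ 'n) set" where U: "finite U" "\<And>u. u \<in> U \<Longrightarrow> norm u = 1"
      "real (card U) \<le> (20 * real ?d) ^ ?d * ?D \<delta>"
      "\<And>v. norm v = 1 \<Longrightarrow> \<exists>u\<in>U. norm (v - u) \<le> \<delta> / 4"
      using sphere_cover[OF \<delta>, where 'a = "real ^ 'n"] by auto
    obtain N where N: "finite N"
      "real (card N) \<le> real (card U) * ((2 * real ?d + 1)\<^sup>2 / \<epsilon>) ^ (2 * ?d)"
      "\<And>x y. (x, y) \<in> N \<Longrightarrow> 1 - \<delta> \<le> dist x y"
      "\<And>\<F>'. \<F>' \<subseteq> \<F> \<Longrightarrow> \<epsilon> * real (card \<F>) \<le> real (card \<F>') \<Longrightarrow>
         \<exists>(x, y)\<in>N. {x, y} \<subseteq> convex hull (\<Union>\<F>')"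
      using segment_net[of \<F> \<delta> \<epsilon> U] \<F> \<delta> \<epsilon> U by auto
    note N(2)
    also have "real (card U) * ((2 * real ?d + 1)\<^sup>2 / \<epsilon>) ^ (2 * ?d)
        \<le> (20 * real ?d) ^ ?d * ?D \<delta> * ((2 * real ?d + 1)\<^sup>2 / \<epsilon>) ^ (2 * ?d)"
      using U(3) \<epsilon> by (intro mult_right_mono) auto
    also have "((2 * real ?d + 1)\<^sup>2 / \<epsilon>) ^ (2 * ?d)
        = ((2 * real ?d + 1)\<^sup>2) ^ (2 * ?d) * \<epsilon> powi (- int (2 * ?d))"
      unfolding power_int_minus power_int_of_nat by (simp add: power_mult_distrib divide_inverse power_inverse)
    also have "(20 * real ?d) ^ ?d * ?D \<delta> * (((2 * real ?d + 1)\<^sup>2) ^ (2 * ?d) * \<epsilon> powi (- int (2 * ?d)))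
        = bnd \<delta> \<epsilon>"
      by (simp add: bnd_def C_def)
    finally have cardN: "card N \<le> m \<delta> \<epsilon>"
      by (simp add: m_def le_nat_floor)
    obtain h where h: "bij_betw h {1..card N} N"
      using ex_bij_betw_nat_finite_1[OF N(1)] by blast
    \<comment> \<open>The net may have fewer than \<open>m \<delta> \<epsilon>\<close> points. The
      surplus indices receive \<open>UNIV\<close>, which is unbounded and thus of infinite diameter
      in the intended sense; the diameter condition is imposed on bounded sets only.\<close>
    define K where "K i = (if i \<le> card N then {fst (h i), snd (h i)} else UNIV)" for i
    have "1 - \<delta> \<le> diameter (K i)" if "i \<in> {1..m \<delta> \<epsilon>}" "bounded (K i)" for i
    proof -
      have "i \<le> card N"
        using that(2) by (auto simp: K_def not_bounded_UNIV split: if_splits)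
      then have "(fst (h i), snd (h i)) \<in> N"
        using h that(1) by (auto simp: bij_betw_def)
      then have "1 - \<delta> \<le> dist (fst (h i)) (snd (h i))"
        by (rule N(3))
      also have "\<dots> \<le> diameter (K i)"
        using \<open>i \<le> card N\<close> by (intro diameter_bounded_bound that) (auto simp: K_def)
      finally show ?thesis .
    qed
    moreover have "\<exists>i\<in>{1..m \<delta> \<epsilon>}. K i \<subseteq> convex hull (\<Union>\<F>')"
      if \<F>': "\<F>' \<subseteq> \<F>" "\<epsilon> * real (card \<F>) \<le> real (card \<F>')" for \<F>'
    proof -
      obtain z where z: "z \<in> N" "{fst z, snd z} \<subseteq> convex hull (\<Union>\<F>')"
        using N(4)[OF \<F>'] by auto
      then obtain i where "i \<in> {1..card N}" "z = h i"
        using h by (metis bij_betw_imp_surj_on imageE)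
      then show ?thesis
        using z cardN by (intro bexI[of _ i]) (auto simp: K_def)
    qed
    ultimately show "\<exists>K :: nat \<Rightarrow> (real ^ 'n) set.
             (\<forall>i\<in>{1..m \<delta> \<epsilon>}. bounded (K i) \<longrightarrow> 1 - \<delta> \<le> diameter (K i)) \<and>
             (\<forall>\<F>'\<subseteq>\<F>. \<epsilon> * real (card \<F>) \<le> real (card \<F>') \<longrightarrow>
                (\<exists>i\<in>{1..m \<delta> \<epsilon>}. K i \<subseteq> convex hull (\<Union>\<F>')))"
      by blast
  qed
  note main = this[unfolded bnd_def]
  show ?thesis
    by (intro exI[of _ m] exI[of _ C] allI impI, elim conjE) (rule main)
qed

end
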